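(* Let $h\ge 2$ be an even integer and let $r\ge 1$ be an integer. Then the graph $X_{h,r}$ is an integral graph (all eigenvalues of its adjacency matrix are integers), and its adjacency spectrum is $$\Lambda(X_{h,r})=\left\{[rh]^1,\ [1-h]^r,\ [1]^{r\left(\frac h2-1\right)},\ [0]^{h-2},\ [-1]^{\frac{rh}{2}}\right\}.$$
   Context: All graphs are finite, simple and undirected. For an even integer $h\ge 2$ and an integer $r\ge 1$, the graph $X_{h,r}$ is defined as the join $$X_{h,r}=\overline{K}_{h-1}\vee\left(\bigvee_{i=1}^{r}\left(\tfrac h2\right)K_2\right),$$ where $\overline{K}_{h-1}$ is the edgeless graph on $h-1$ vertices, $\left(\frac h2\right)K_2$ is the disjoint union of $\frac h2$ copies of $K_2$, and the join $\vee$ of pairwise vertex-disjoint graphs is obtained from their disjoint union by adding all edges between vertices of different constituents. Thus the vertex set is partitioned into $V_0,V_1,\dots,V_r$ with $V_0$ inducing $\overline{K}_{h-1}$, each $V_i$ ($1\le i\le r$) inducing $\left(\frac h2\right)K_2$, and all vertices in different parts adjacent. The adjacency spectrum $\Lambda(\mathcal G)$ is the multiset of eigenvalues of the adjacency matrix, counted with multiplicity; $[\lambda]^k$ means that $\lambda$ is listed $k$ times. If two listed values coincide (as $1-h=-1$ when $h=2$), their multiplicities are added; an entry with exponent $0$ does not occur. *)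

theory Defs
  imports
    "HOL-Library.Multiset"
    "HOL-Computational_Algebra.Polynomial"
    "Graph_Theory.Kuratowski"
    "Jordan_Normal_Form.Char_Poly"
begin

text \<open>
  A finite simple undirected graph is a \<^locale>\<open>pair_graph\<close>: a finite, loop-free symmetric
  digraph without parallel arcs, where an undirected edge is the pair of its two orientations.
\<close>

definition empty_graph :: "nat \<Rightarrow> nat pair_pre_digraph" where
  "empty_graph n = \<lparr> pverts = {..<n}, parcs = {} \<rparr>"

definition complete_graph :: "nat \<Rightarrow> nat pair_pre_digraph" where
  "complete_graph n = \<lparr> pverts = {..<n}, parcs = {(u, v). u < n \<and> v < n \<and> u \<noteq> v} \<rparr>"

text \<open>
  Vertices of the constituents are tagged with their index (or with \<^const>\<open>Inl\<close> and \<^const>\<open>Inr\<close>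
  in the binary case), so that the constituents are always vertex-disjoint.
\<close>

definition disjoint_union_graph ::
    "'i set \<Rightarrow> ('i \<Rightarrow> 'a pair_pre_digraph) \<Rightarrow> ('i \<times> 'a) pair_pre_digraph" where
  "disjoint_union_graph I G =
     \<lparr> pverts = (SIGMA i:I. pverts (G i)),
       parcs = {((i, u), (i, v)) | i u v. i \<in> I \<and> (u, v) \<in> parcs (G i)} \<rparr>"

definition big_join_graph ::
    "'i set \<Rightarrow> ('i \<Rightarrow> 'a pair_pre_digraph) \<Rightarrow> ('i \<times> 'a) pair_pre_digraph" where
  "big_join_graph I G =
     \<lparr> pverts = pverts (disjoint_union_graph I G),
       parcs = parcs (disjoint_union_graph I G) \<union>
         {((i, u), (j, v)) | i j u v.
            i \<in> I \<and> j \<in> I \<and> i \<noteq> j \<and> u \<in> pverts (G i) \<and> v \<in> pverts (G j)} \<rparr>"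

definition join_graph ::
    "'a pair_pre_digraph \<Rightarrow> 'b pair_pre_digraph \<Rightarrow> ('a + 'b) pair_pre_digraph" where
  "join_graph G H =
     \<lparr> pverts = Inl ` pverts G \<union> Inr ` pverts H,
       parcs = {(Inl u, Inl v) | u v. (u, v) \<in> parcs G} \<union>
         {(Inr u, Inr v) | u v. (u, v) \<in> parcs H} \<union>
         {(Inl u, Inr v) | u v. u \<in> pverts G \<and> v \<in> pverts H} \<union>
         {(Inr v, Inl u) | u v. u \<in> pverts G \<and> v \<in> pverts H} \<rparr>"

definition X_graph :: "nat \<Rightarrow> nat \<Rightarrow> (nat + nat \<times> nat \<times> nat) pair_pre_digraph" where
  "X_graph h r =
     join_graph (empty_graph (h - 1))
       (big_join_graph {1..r} (\<lambda>i. disjoint_union_graph {1..h div 2} (\<lambda>j. complete_graph 2)))"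

definition adjacency_matrix :: "'a list \<Rightarrow> 'a pair_pre_digraph \<Rightarrow> complex mat" where
  "adjacency_matrix vs G =
     mat (length vs) (length vs) (\<lambda>(i, j). if (vs ! i, vs ! j) \<in> parcs G then 1 else 0)"

definition is_vertex_enum :: "'a list \<Rightarrow> 'a pair_pre_digraph \<Rightarrow> bool" where
  "is_vertex_enum vs G \<longleftrightarrow> distinct vs \<and> set vs = pverts G"

text \<open>
  The following two notions use an arbitrary enumeration of the vertices; they do not depend on it,
  see \<open>adjacency_spectrum_eq\<close> and \<open>integral_graph_iff\<close> below.
\<close>

definition vertex_enum :: "'a pair_pre_digraph \<Rightarrow> 'a list" where
  "vertex_enum G = (SOME vs. is_vertex_enum vs G)"

definition adjacency_spectrum :: "'a pair_pre_digraph \<Rightarrow> complex multiset" where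
  "adjacency_spectrum G = proots (char_poly (adjacency_matrix (vertex_enum G) G))"

definition integral_graph :: "'a pair_pre_digraph \<Rightarrow> bool" where
  "integral_graph G \<longleftrightarrow>
     (\<forall>\<mu>. eigenvalue (adjacency_matrix (vertex_enum G) G) \<mu> \<longrightarrow> \<mu> \<in> \<int>)"

lemma adjacency_matrix_carrier:
  "adjacency_matrix vs G \<in> carrier_mat (length vs) (length vs)"
  by (simp add: adjacency_matrix_def)

lemma is_vertex_enum_vertex_enum:
  assumes "finite (pverts G)"
  shows "is_vertex_enum (vertex_enum G) G"
proof -
  have "\<exists>vs. is_vertex_enum vs G"
    using finite_distinct_list[OF assms] by (auto simp: is_vertex_enum_def)
  then show ?thesis
    unfolding vertex_enum_def by (rule someI_ex)
qed

lemma det_permute_rows_cols: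
  fixes A :: "'a :: comm_ring_1 mat"
  assumes A: "A \<in> carrier_mat n n" and p: "p permutes {0..<n}"
  shows "det (mat n n (\<lambda>(i, j). A $$ (p i, p j))) = det A"
proof -
  let ?B = "mat n n (\<lambda>(i, j). A $$ (p i, j))"
  let ?C = "mat n n (\<lambda>(i, j). A $$ (p i, p j))"
  have pn: "p i < n" if "i < n" for i
    using permutes_in_image[OF p, of i] that by simp
  have "det ?C = det (transpose_mat ?C)"
    by (rule det_transpose[symmetric, of _ n]) simp
  also have "transpose_mat ?C = mat n n (\<lambda>(i, j). transpose_mat ?B $$ (p i, j))"
    by (rule eq_matI) (auto simp: pn)
  also have "det \<dots> = signof p * det (transpose_mat ?B)"
    by (rule det_permute_rows[OF _ p]) simp
  also have "det (transpose_mat ?B) = det ?B"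
    by (rule det_transpose[of _ n]) simp
  also have "det ?B = signof p * det A"
    by (rule det_permute_rows[OF A p])
  also have "signof p * (signof p * det A) = det A"
    by (simp add: sign_def)
  finally show ?thesis .
qed

lemma char_poly_adjacency_matrix_enum:
  assumes "is_vertex_enum vs G" "is_vertex_enum ws G"
  shows "char_poly (adjacency_matrix vs G) = char_poly (adjacency_matrix ws G)"
proof -
  define n where "n = length ws"
  have d: "distinct vs" "distinct ws" "set vs = set ws"
    using assms by (auto simp: is_vertex_enum_def)
  have "mset vs = mset ws"
    using d by (simp add: set_eq_iff_mset_eq_distinct)
  then obtain p where p: "p permutes {..<length ws}" and vs: "permute_list p ws = vs"
    by (rule mset_eq_permutation)
  have p': "p permutes {0..<n}"
    using p by (simp add: n_def lessThan_atLeast0)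
  have len: "length vs = n"
    using vs by (auto simp: n_def)
  have pn: "p i < n" if "i < n" for i
    using permutes_in_image[OF p', of i] that by simp
  have nth: "vs ! i = ws ! p i" if "i < n" for i
    using permute_list_nth[OF p, of i] that vs by (simp add: n_def)
  have inj: "p i = p j \<longleftrightarrow> i = j" for i j
    using permutes_inj[OF p'] by (auto dest: injD)
  let ?M = "char_poly_matrix (adjacency_matrix ws G)"
  have "char_poly_matrix (adjacency_matrix vs G) = mat n n (\<lambda>(i, j). ?M $$ (p i, p j))"
    by (rule eq_matI)
      (auto simp: char_poly_matrix_def adjacency_matrix_def len n_def[symmetric] pn nth inj)
  moreover have "?M \<in> carrier_mat n n"
    unfolding n_def by (intro char_poly_matrix_closed adjacency_matrix_carrier)
  ultimately show ?thesis
    unfolding char_poly_def using det_permute_rows_cols[OF _ p'] by metis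
qed

lemma adjacency_spectrum_eq:
  assumes "finite (pverts G)" "is_vertex_enum vs G"
  shows "adjacency_spectrum G = proots (char_poly (adjacency_matrix vs G))"
  unfolding adjacency_spectrum_def
  using char_poly_adjacency_matrix_enum[OF is_vertex_enum_vertex_enum[OF assms(1)] assms(2)]
  by simp

lemma integral_graph_iff:
  assumes "finite (pverts G)" "is_vertex_enum vs G"
  shows "integral_graph G \<longleftrightarrow> (\<forall>\<mu>. eigenvalue (adjacency_matrix vs G) \<mu> \<longrightarrow> \<mu> \<in> \<int>)"
  unfolding integral_graph_def eigenvalue_root_char_poly[OF adjacency_matrix_carrier]
  using char_poly_adjacency_matrix_enum[OF is_vertex_enum_vertex_enum[OF assms(1)] assms(2)]
  by simp

lemma pair_graphI:
  assumes "finite (pverts G)"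
    and "\<And>u v. (u, v) \<in> parcs G \<Longrightarrow> u \<in> pverts G \<and> v \<in> pverts G \<and> u \<noteq> v \<and> (v, u) \<in> parcs G"
  shows "pair_graph G"
proof -
  have "parcs G \<subseteq> pverts G \<times> pverts G"
    using assms(2) by auto
  then have "finite (parcs G)"
    using assms(1) by (meson finite_SigmaI finite_subset)
  then show ?thesis
    using assms by unfold_locales (auto simp: symmetric_def intro!: symI)
qed

lemma pair_graphD:
  assumes "pair_graph G"
  shows "finite (pverts G)"
    and "(u, v) \<in> parcs G \<Longrightarrow> u \<in> pverts G \<and> v \<in> pverts G \<and> u \<noteq> v \<and> (v, u) \<in> parcs G"
proof -
  interpret pair_graph G by fact
  show "finite (pverts G)" by (rule pair_finite_verts)
  show "u \<in> pverts G \<and> v \<in> pverts G \<and> u \<noteq> v \<and> (v, u) \<in> parcs G" if "(u, v) \<in> parcs G"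
    using that in_arcsD1 in_arcsD2 pair_no_loops[of "(u, v)"] pair_sym_arcs
    by (auto simp: symmetric_def dest: symD)
qed

lemma pair_graph_empty_graph: "pair_graph (empty_graph n)"
  by (rule pair_graphI) (auto simp: empty_graph_def)

lemma pair_graph_complete_graph: "pair_graph (complete_graph n)"
  by (rule pair_graphI) (auto simp: complete_graph_def)

lemma complete_digraph_complete_graph: "complete_digraph n (with_proj (complete_graph n))"
  by (auto simp: complete_digraph_pair_def complete_graph_def)

lemma pair_graph_disjoint_union_graph:
  assumes "finite I" "\<And>i. i \<in> I \<Longrightarrow> pair_graph (G i)"
  shows "pair_graph (disjoint_union_graph I G)"
proof (rule pair_graphI)
  show "finite (pverts (disjoint_union_graph I G))"
    using assms pair_graphD(1) by (auto simp: disjoint_union_graph_def intro!: finite_SigmaI)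
next
  fix x y
  assume "(x, y) \<in> parcs (disjoint_union_graph I G)"
  then obtain i u v where "x = (i, u)" "y = (i, v)" "i \<in> I" "(u, v) \<in> parcs (G i)"
    by (auto simp: disjoint_union_graph_def)
  then show "x \<in> pverts (disjoint_union_graph I G) \<and> y \<in> pverts (disjoint_union_graph I G) \<and>
      x \<noteq> y \<and> (y, x) \<in> parcs (disjoint_union_graph I G)"
    using pair_graphD(2)[OF assms(2), of i u v] by (simp add: disjoint_union_graph_def)
qed

lemma pair_graph_big_join_graph:
  assumes "finite I" "\<And>i. i \<in> I \<Longrightarrow> pair_graph (G i)"
  shows "pair_graph (big_join_graph I G)"
proof (rule pair_graphI)
  have "pair_graph (disjoint_union_graph I G)"
    using assms by (rule pair_graph_disjoint_union_graph)
  note D = pair_graphD[OF this]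
  show "finite (pverts (big_join_graph I G))"
    using D(1) by (simp add: big_join_graph_def)
  fix x y
  assume "(x, y) \<in> parcs (big_join_graph I G)"
  then consider "(x, y) \<in> parcs (disjoint_union_graph I G)"
    | i j u v where "x = (i, u)" "y = (j, v)" "i \<in> I" "j \<in> I" "i \<noteq> j"
        "u \<in> pverts (G i)" "v \<in> pverts (G j)"
    by (auto simp: big_join_graph_def)
  then show "x \<in> pverts (big_join_graph I G) \<and> y \<in> pverts (big_join_graph I G) \<and>
      x \<noteq> y \<and> (y, x) \<in> parcs (big_join_graph I G)"
  proof cases
    case 1
    then show ?thesis
      using D(2)[OF 1] by (simp add: big_join_graph_def)
  next
    case 2
    then show ?thesis
      by (simp add: big_join_graph_def disjoint_union_graph_def)
  qed
qed

lemma pair_graph_join_graph: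
  assumes "pair_graph G" "pair_graph H"
  shows "pair_graph (join_graph G H)"
  using pair_graphD[OF assms(1)] pair_graphD[OF assms(2)]
  by (intro pair_graphI) (auto simp: join_graph_def)

lemma pair_graph_X_graph: "pair_graph (X_graph h r)"
  unfolding X_graph_def
  by (intro pair_graph_join_graph pair_graph_empty_graph pair_graph_big_join_graph
      pair_graph_disjoint_union_graph pair_graph_complete_graph finite_atLeastAtMost)

end

theory Submission
  imports Defs
begin

text \<open>
  Let \<open>J\<close> be the all-ones matrix. Adding \<open>J\<close> to \<open>xI - A\<close> cancels the entries between different
  parts of the join, so \<open>xI - A + J\<close> is block diagonal with one block per part. For an \<open>n \<times> n\<close>
  matrix with constant row sum \<open>c\<close>, adding \<open>t\<close> to every entry multiplies the determinant by
  \<open>(c + n t) / c\<close>. As the graph and all its parts are regular, this applies twice: once to pass from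
  \<open>xI - A\<close> to \<open>xI - A + J\<close>, and once within each block to remove the summand \<open>J\<close> again, where what
  remains is block diagonal with blocks of size one or two.
\<close>

section \<open>Determinants of matrices with constant row sums\<close>

text \<open>The first factor on the right does not involve \<open>t\<close>, so the dependence on
  \<open>t\<close> is confined to the linear factor \<open>c + of_nat n * t\<close>. No division
  occurs, so \<open>c\<close> may be zero or a zero divisor.\<close>

lemma det_add_const_aux:
  fixes A :: "'a :: comm_ring_1 mat"
  assumes A: "A \<in> carrier_mat n n" and n: "n > 0"
    and row: "\<And>i. i < n \<Longrightarrow> (\<Sum>j<n. A $$ (i, j)) = c"
  shows "det (mat n n (\<lambda>(i, j). A $$ (i, j) + t)) =
    det (mat n n (\<lambda>(i, j). if j = 0 then 1 else A $$ (i, j))) * (c + of_nat n * t)"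
proof -
  define B where "B = mat n n (\<lambda>(i, j). A $$ (i, j) + t)"
  define N where "N = mat n n (\<lambda>(i, j). if j = 0 then 1 else A $$ (i, j))"
  \<comment> \<open>Right multiplication by \<open>E\<close> replaces column 0 of \<open>B\<close>
    by its constant row sums. The result has column 0 proportional to the all-ones vector, and
    \<open>F\<close> writes its columns in terms of those of \<open>N\<close>. Both \<open>E\<close>
    and \<open>F\<close> are triangular.\<close>
  define E :: "'a mat" where "E = mat n n (\<lambda>(i, j). if i = j \<or> j = 0 then 1 else 0)"
  define F where "F = mat n n (\<lambda>(i, j). if i = 0 then (if j = 0 then c + of_nat n * t else t)
    else if i = j then 1 else 0)"
  have carrier: "B \<in> carrier_mat n n" "N \<in> carrier_mat n n" "E \<in> carrier_mat n n"
    "F \<in> carrier_mat n n"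
    by (simp_all add: B_def N_def E_def F_def)
  have "det E = prod_list (diag_mat E)"
    by (rule det_lower_triangular[of n]) (auto simp: E_def)
  also have "\<dots> = 1"
    by (rule prod_list_neutral) (auto simp: diag_mat_def E_def)
  finally have det_E: "det E = 1" .
  have "det F = prod_list (diag_mat F)"
    by (rule det_upper_triangular[of _ n]) (auto simp: F_def)
  also have "\<dots> = (\<Prod>i = 0..<n. if i = 0 then c + of_nat n * t else 1)"
    unfolding prod_list_diag_prod by (rule prod.cong) (auto simp: F_def)
  also have "\<dots> = c + of_nat n * t"
    using n by (simp add: prod.delta)
  finally have det_F: "det F = c + of_nat n * t" .
  have "B * E = N * F"
  proof (rule eq_matI)
    fix i j
    assume "i < dim_row (N * F)" "j < dim_col (N * F)"
    then have ij: "i < n" "j < n"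
      using carrier by auto
    have BE: "(B * E) $$ (i, j) = (\<Sum>k = 0..<n. B $$ (i, k) * E $$ (k, j))"
      using ij carrier by (auto simp: scalar_prod_def)
    have NF: "(N * F) $$ (i, j) = (\<Sum>k = 0..<n. N $$ (i, k) * F $$ (k, j))"
      using ij carrier by (auto simp: scalar_prod_def)
    show "(B * E) $$ (i, j) = (N * F) $$ (i, j)"
    proof (cases "j = 0")
      case True
      have "(B * E) $$ (i, j) = (\<Sum>k = 0..<n. A $$ (i, k) + t)"
        unfolding BE by (rule sum.cong) (use ij True in \<open>auto simp: B_def E_def\<close>)
      also have "\<dots> = c + of_nat n * t"
        using row[OF ij(1)] by (simp add: sum.distrib lessThan_atLeast0)
      also have "\<dots> = (\<Sum>k = 0..<n. if k = 0 then c + of_nat n * t else 0)"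
        using n by simp
      also have "\<dots> = (N * F) $$ (i, j)"
        unfolding NF by (rule sum.cong) (use ij True in \<open>auto simp: N_def F_def\<close>)
      finally show ?thesis .
    next
      case False
      have "(B * E) $$ (i, j) = (\<Sum>k = 0..<n. if k = j then A $$ (i, j) + t else 0)"
        unfolding BE by (rule sum.cong) (use ij False in \<open>auto simp: B_def E_def\<close>)
      also have "\<dots> = (\<Sum>k = 0..<n. (if k = 0 then t else 0) + (if k = j then A $$ (i, j) else 0))"
        using ij n by (simp add: sum.distrib)
      also have "\<dots> = (N * F) $$ (i, j)"
        unfolding NF by (rule sum.cong) (use ij False in \<open>auto simp: N_def F_def\<close>)
      finally show ?thesis .
    qed
  qed (use carrier in auto)
  then have "det B * det E = det N * det F"
    using det_mult[OF carrier(1,3)] det_mult[OF carrier(2,4)] by simp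
  then show ?thesis
    by (simp add: det_E det_F B_def N_def)
qed

text \<open>Compare the factorisation for \<open>t\<close> with the one for \<open>t = 0\<close>,
  where the matrix is \<open>A\<close> itself. Cross-multiplying eliminates the common
  factor.\<close>

lemma det_add_const:
  fixes A :: "'a :: comm_ring_1 mat"
  assumes A: "A \<in> carrier_mat n n"
    and row: "\<And>i. i < n \<Longrightarrow> (\<Sum>j<n. A $$ (i, j)) = c"
  shows "det (mat n n (\<lambda>(i, j). A $$ (i, j) + t)) * c = det A * (c + of_nat n * t)"
proof (cases "n = 0")
  case True
  then show ?thesis
    using A by (simp add: det_def)
next
  case False
  have "mat n n (\<lambda>(i, j). A $$ (i, j) + 0) = A"
    using A by (intro eq_matI) auto
  then show ?thesis
    using det_add_const_aux[OF A _ row, where t = t] det_add_const_aux[OF A _ row, where t = 0] False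
    by (simp add: ac_simps)
qed

section \<open>Matrices indexed by the elements of a list\<close>

text \<open>Indexing by list elements turns concatenation of lists into block decomposition, without
  index arithmetic.\<close>

definition list_mat :: "'b list \<Rightarrow> ('b \<Rightarrow> 'b \<Rightarrow> 'a) \<Rightarrow> 'a mat" where
  "list_mat vs f = mat (length vs) (length vs) (\<lambda>(i, j). f (vs ! i) (vs ! j))"

lemma list_mat_carrier: "list_mat vs f \<in> carrier_mat (length vs) (length vs)"
  by (simp add: list_mat_def)

lemma list_mat_map: "list_mat (map g vs) f = list_mat vs (\<lambda>u v. f (g u) (g v))"
  by (rule eq_matI) (auto simp: list_mat_def)

lemma list_mat_cong:
  assumes "\<And>u v. u \<in> set vs \<Longrightarrow> v \<in> set vs \<Longrightarrow> f u v = g u v"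
  shows "list_mat vs f = list_mat vs g"
  using assms by (intro eq_matI) (auto simp: list_mat_def)

lemma det_list_mat_add_const:
  fixes f :: "'b \<Rightarrow> 'b \<Rightarrow> 'a :: comm_ring_1"
  assumes "\<And>u. u \<in> set vs \<Longrightarrow> (\<Sum>v\<leftarrow>vs. f u v) = c"
  shows "det (list_mat vs (\<lambda>u v. f u v + t)) * c = det (list_mat vs f) * (c + of_nat (length vs) * t)"
proof -
  have "(\<Sum>j<length vs. list_mat vs f $$ (i, j)) = c" if "i < length vs" for i
    using assms[of "vs ! i"] that
    by (simp add: list_mat_def sum_list_sum_nth lessThan_atLeast0)
  moreover have "mat (length vs) (length vs) (\<lambda>(i, j). list_mat vs f $$ (i, j) + t) =
      list_mat vs (\<lambda>u v. f u v + t)"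
    by (rule eq_matI) (auto simp: list_mat_def)
  ultimately show ?thesis
    using det_add_const[OF list_mat_carrier, of vs f c t] by simp
qed

lemma det_list_mat_append:
  fixes f :: "'b \<Rightarrow> 'b \<Rightarrow> 'a :: idom"
  assumes "\<And>u v. u \<in> set ws \<Longrightarrow> v \<in> set vs \<Longrightarrow> f u v = 0"
  shows "det (list_mat (vs @ ws) f) = det (list_mat vs f) * det (list_mat ws f)"
proof -
  let ?m = "length vs" and ?n = "length ws"
  let ?B = "mat ?m ?n (\<lambda>(i, j). f (vs ! i) (ws ! j))"
  have "list_mat (vs @ ws) f =
      four_block_mat (list_mat vs f) ?B (0\<^sub>m ?n ?m) (list_mat ws f)"
    using assms by (intro eq_matI) (auto simp: list_mat_def nth_append)
  then show ?thesis
    using det_four_block_mat_lower_left_zero[OF list_mat_carrier[of vs f], of ?B ?n "0\<^sub>m ?n ?m"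
        "list_mat ws f"] list_mat_carrier[of ws f]
    by simp
qed

text \<open>The pairwise condition on earlier and later blocks says that the matrix is block upper
  triangular; peel off one block at a time.\<close>

lemma det_list_mat_concat:
  fixes f :: "'b \<Rightarrow> 'b \<Rightarrow> 'a :: idom"
  assumes "sorted_wrt (\<lambda>vs ws. \<forall>v\<in>set vs. \<forall>w\<in>set ws. f w v = 0) vss"
  shows "det (list_mat (concat vss) f) = (\<Prod>vs\<leftarrow>vss. det (list_mat vs f))"
  using assms
proof (induction vss)
  case Nil
  then show ?case
    by (simp add: list_mat_def det_def)
next
  case (Cons vs vss)
  have "det (list_mat (vs @ concat vss) f) = det (list_mat vs f) * det (list_mat (concat vss) f)"
    by (rule det_list_mat_append) (use Cons.prems in auto)
  then show ?case
    using Cons by simp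
qed

lemma det_list_mat_diagonal:
  assumes "distinct vs"
  shows "det (list_mat vs (\<lambda>u v. if u = v then x else 0 :: 'a :: idom)) = x ^ length vs"
  using assms
proof (induction vs)
  case Nil
  then show ?case
    by (simp add: list_mat_def det_def)
next
  case (Cons v vs)
  have "det (list_mat [v] (\<lambda>u v. if u = v then x else 0)) = x"
    by (simp add: list_mat_def det_single)
  moreover have "det (list_mat ([v] @ vs) (\<lambda>u v. if u = v then x else 0)) =
      det (list_mat [v] (\<lambda>u v. if u = v then x else 0)) *
      det (list_mat vs (\<lambda>u v. if u = v then x else 0))"
    by (rule det_list_mat_append) (use Cons.prems in auto)
  ultimately show ?case
    using Cons by simp
qed


text \<open>A row meets only its own block. The entries have to vanish on both sides of that block,
  so triangularity would not suffice here.\<close>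

lemma sum_list_concat_blocks:
  fixes f :: "'b \<Rightarrow> 'b \<Rightarrow> 'a :: comm_monoid_add"
  assumes "sorted_wrt (\<lambda>vs ws. \<forall>v\<in>set vs. \<forall>w\<in>set ws. f v w = 0 \<and> f w v = 0) vss"
    and "\<And>vs v. vs \<in> set vss \<Longrightarrow> v \<in> set vs \<Longrightarrow> (\<Sum>w\<leftarrow>vs. f v w) = c"
    and "v \<in> set (concat vss)"
  shows "(\<Sum>w\<leftarrow>concat vss. f v w) = c"
  using assms
proof (induction vss)
  case Nil
  then show ?case
    by simp
next
  case (Cons vs vss)
  show ?case
  proof (cases "v \<in> set vs")
    case True
    then have "(\<Sum>w\<leftarrow>concat vss. f v w) = 0"
      using Cons.prems(1) by (intro sum_list_neutral) auto
    then show ?thesis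
      using Cons.prems(2)[of vs v] True by simp
  next
    case False
    then have v: "v \<in> set (concat vss)"
      using Cons.prems(3) by auto
    then have "(\<Sum>w\<leftarrow>vs. f v w) = 0"
      using Cons.prems(1) by (intro sum_list_neutral) auto
    moreover have "(\<Sum>w\<leftarrow>concat vss. f v w) = c"
      using Cons.prems v by (intro Cons.IH) auto
    ultimately show ?thesis
      by simp
  qed
qed

text \<open>Distinctness lets equality of vertices stand for equality of indices, that is, for the
  diagonal.\<close>

lemma char_poly_adjacency_matrix:
  assumes "distinct vs"
  shows "char_poly (adjacency_matrix vs G) =
    det (list_mat vs (\<lambda>u v. (if u = v then [:0, 1:] else 0) - (if (u, v) \<in> parcs G then 1 else 0)))"
proof -
  have "char_poly_matrix (adjacency_matrix vs G) =
      list_mat vs (\<lambda>u v. (if u = v then [:0, 1:] else 0) - (if (u, v) \<in> parcs G then 1 else 0))"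
    using assms
    by (intro eq_matI)
      (auto simp: char_poly_matrix_def adjacency_matrix_def list_mat_def nth_eq_iff_index_eq)
  then show ?thesis
    by (simp add: char_poly_def)
qed

section \<open>The characteristic polynomial of the join\<close>

definition matching_enum :: "nat \<Rightarrow> nat \<Rightarrow> (nat \<times> nat \<times> nat) list" where
  "matching_enum m i = concat (map (\<lambda>j. [(i, j, 0), (i, j, 1)]) [1..<Suc m])"

definition X_enum :: "nat \<Rightarrow> nat \<Rightarrow> (nat + nat \<times> nat \<times> nat) list" where
  "X_enum h r = concat (map Inl [0..<h - 1] # map (\<lambda>i. map Inr (matching_enum (h div 2) i)) [1..<Suc r])"

lemma set_matching_enum: "set (matching_enum m i) = {i} \<times> {1..m} \<times> {..<2}"
  by (auto simp: matching_enum_def)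

lemma length_matching_enum: "length (matching_enum m i) = 2 * m"
  by (simp add: matching_enum_def length_concat comp_def sum_list_triv)

lemma distinct_matching_enum: "distinct (matching_enum m i)"
  unfolding matching_enum_def
  by (induction m) auto

lemma set_X_enum: "set (X_enum h r) = Inl ` {..<h - 1} \<union> Inr ` ({1..r} \<times> {1..h div 2} \<times> {..<2})"
  by (auto simp: X_enum_def set_matching_enum)

lemma length_X_enum: "length (X_enum h r) = h - 1 + r * (2 * (h div 2))"
  by (simp add: X_enum_def length_concat length_matching_enum comp_def sum_list_triv)

lemma distinct_X_enum: "distinct (X_enum h r)"
  by (induction r)
    (auto simp: X_enum_def distinct_map distinct_matching_enum set_matching_enum)

lemma is_vertex_enum_X_enum: "is_vertex_enum (X_enum h r) (X_graph h r)"
  unfolding is_vertex_enum_def set_X_enum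
  by (auto simp: distinct_X_enum X_graph_def join_graph_def empty_graph_def
      big_join_graph_def disjoint_union_graph_def complete_graph_def)

lemma X_graph_arc_simps:
  "(Inl a, Inl b) \<notin> parcs (X_graph h r)"
  "(Inl a, Inr (i, j, e)) \<in> parcs (X_graph h r) \<longleftrightarrow> a < h - 1 \<and> i \<in> {1..r} \<and> j \<in> {1..h div 2} \<and> e < 2"
  "(Inr (i, j, e), Inl a) \<in> parcs (X_graph h r) \<longleftrightarrow> a < h - 1 \<and> i \<in> {1..r} \<and> j \<in> {1..h div 2} \<and> e < 2"
  "(Inr (i, j, e), Inr (i', j', e')) \<in> parcs (X_graph h r) \<longleftrightarrow>
    i \<in> {1..r} \<and> i' \<in> {1..r} \<and> j \<in> {1..h div 2} \<and> j' \<in> {1..h div 2} \<and> e < 2 \<and> e' < 2 \<and>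
    (i \<noteq> i' \<or> j = j' \<and> e \<noteq> e')"
  by (auto simp: X_graph_def join_graph_def empty_graph_def
      big_join_graph_def disjoint_union_graph_def complete_graph_def)

lemma sorted_wrt_upt_map:
  assumes "\<And>i j. m \<le> i \<Longrightarrow> i < j \<Longrightarrow> j < n \<Longrightarrow> P (f i) (f j)"
  shows "sorted_wrt P (map f [m..<n])"
  using assms by (auto simp: sorted_wrt_iff_nth_less)

text \<open>
  The entries of \<open>xI - A\<close> within one part \<open>(h/2) K\<^sub>2\<close>; the index of the part is ignored.
\<close>

definition matching_entry :: "'a :: comm_ring_1 \<Rightarrow> nat \<times> nat \<times> nat \<Rightarrow> nat \<times> nat \<times> nat \<Rightarrow> 'a" where
  "matching_entry x = (\<lambda>(i, j, e) (i', j', e'). if j = j' then (if e = e' then x else - 1) else 0)"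

text \<open>Each of the \<open>m\<close> edges gives a 2 by 2 block with diagonal \<open>x\<close>
  and off-diagonal entries \<open>- 1\<close>.\<close>

lemma det_matching_entry:
  "det (list_mat (matching_enum m i) (matching_entry (x :: 'a :: idom))) = (x\<^sup>2 - 1) ^ m"
proof -
  have "det (list_mat [(i, j, 0), (i, j, 1)] (matching_entry x)) = x\<^sup>2 - 1" for j
    by (subst laplace_expansion_row[of _ 2 0])
      (auto simp: list_mat_def matching_entry_def power2_eq_square cofactor_def mat_delete_def
        det_single numeral_2_eq_2)
  then show ?thesis
    unfolding matching_enum_def
    by (subst det_list_mat_concat)
      (auto intro!: sorted_wrt_upt_map simp del: upt_Suc
        simp: matching_entry_def comp_def prod_list_replicate map_replicate_const)
qed

text \<open>Within its part, each vertex has exactly one neighbour, the other end of its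
  edge.\<close>

lemma row_sum_matching_entry:
  assumes "v \<in> set (matching_enum m i)"
  shows "(\<Sum>w\<leftarrow>matching_enum m i. matching_entry x v w) = x - 1"
  using assms unfolding matching_enum_def
  by (intro sum_list_concat_blocks)
    (auto intro!: sorted_wrt_upt_map simp del: upt_Suc simp: matching_entry_def)

text \<open>The determinant identities are kept in cross-multiplied form. The factors
  \<open>x\<close>, \<open>(x - 1) ^ r\<close> and \<open>x + of_nat (h - 1)\<close> that accumulate
  on the left are cancelled only at the end.\<close>

lemma char_poly_X_graph:
  assumes h: "even h" "h \<ge> 2"
  shows "char_poly (adjacency_matrix (X_enum h r) (X_graph h r)) =
    [:- of_nat (r * h), 1:] * [:of_nat h - 1, 1:] ^ r * [:- 1, 1:] ^ (r * (h div 2 - 1)) *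
    [:0, 1:] ^ (h - 2) * [:1, 1:] ^ (r * h div 2)"
proof -
  define x :: "complex poly" where "x = [:0, 1:]"
  define m where "m = h div 2"
  have hm: "h = 2 * m" "m > 0"
    using h by (auto simp: m_def)
  define f :: "nat + nat \<times> nat \<times> nat \<Rightarrow> nat + nat \<times> nat \<times> nat \<Rightarrow> complex poly" where
    "f = (\<lambda>u v. (if u = v then x else 0) - (if (u, v) \<in> parcs (X_graph h r) then 1 else 0))"
  \<comment> \<open>\<open>f\<close> gives the entries of \<open>xI - A\<close>, and
    \<open>g\<close> those of \<open>xI - A + J\<close>.\<close>
  define g where "g = (\<lambda>u v. f u v + 1)"
  define V where "V = map Inl [0..<h - 1] # map (\<lambda>i. map Inr (matching_enum m i)) [1..<Suc r]"
  have X_enum: "X_enum h r = concat V"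
    by (simp add: X_enum_def V_def m_def)
  \<comment> \<open>Vertices in different parts are adjacent, so the entry \<open>- 1\<close> of
    \<open>f\<close> is cancelled by the added 1.\<close>
  have blocks: "sorted_wrt (\<lambda>vs ws. \<forall>v\<in>set vs. \<forall>w\<in>set ws. g v w = 0 \<and> g w v = 0) V"
    unfolding V_def
    by (auto intro!: sorted_wrt_upt_map simp del: upt_Suc
        simp: g_def f_def set_matching_enum X_graph_arc_simps m_def)
  have blocks': "sorted_wrt (\<lambda>vs ws. \<forall>v\<in>set vs. \<forall>w\<in>set ws. g w v = 0) V"
    using blocks by (rule sorted_wrt_mono_rel[rotated]) auto
  have g_Inl: "g (Inl a) (Inl b) = (if a = b then x else 0) + 1" for a b
    by (simp add: g_def f_def X_graph_arc_simps)
  have g_Inr: "g (Inr v) (Inr w) = matching_entry x v w + 1"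
    if "v \<in> set (matching_enum m i)" "w \<in> set (matching_enum m i)" "i \<in> {1..r}" for v w i
    using that by (auto simp: g_def f_def set_matching_enum X_graph_arc_simps matching_entry_def m_def)
  have row_Inl: "(\<Sum>b\<leftarrow>[0..<h - 1]. if a = b then x else 0) = x" if "a < h - 1" for a
    using that by (simp add: interv_sum_list_conv_sum_set_nat sum.delta)
  \<comment> \<open>Both kinds of part give the same sum: \<open>x\<close> plus \<open>h - 1\<close>
    ones in the edgeless part, and \<open>x - 1\<close> plus \<open>h\<close> ones in a matching
    part. This agreement permits removing \<open>J\<close> from the whole matrix later.\<close>
  have row: "(\<Sum>w\<leftarrow>vs. g v w) = x + of_nat (h - 1)" if vs: "vs \<in> set V" and v: "v \<in> set vs" for vs v
  proof -
    have "vs = map Inl [0..<h - 1] \<or> (\<exists>i\<in>{1..r}. vs = map Inr (matching_enum m i))"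
      using vs by (auto simp: V_def simp del: upt_Suc)
    then consider (Inl) "vs = map Inl [0..<h - 1]"
      | (Inr) i where "i \<in> {1..r}" "vs = map Inr (matching_enum m i)"
      by blast
    then show ?thesis
    proof cases
      case Inl
      then obtain a where a: "v = Inl a" "a < h - 1"
        using v unfolding Inl by auto
      have "(\<Sum>w\<leftarrow>vs. g v w) = (\<Sum>b\<leftarrow>[0..<h - 1]. (if a = b then x else 0) + 1)"
        by (simp add: Inl a comp_def g_Inl)
      then show ?thesis
        using row_Inl[OF a(2)] by (simp add: sum_list_addf sum_list_triv)
    next
      case (Inr i)
      obtain u where u: "v = Inr u" "u \<in> set (matching_enum m i)"
        using v unfolding Inr(2) set_map by (rule imageE)
      have "(\<Sum>w\<leftarrow>vs. g v w) = (\<Sum>w\<leftarrow>matching_enum m i. matching_entry x u w + 1)"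
        unfolding Inr(2) u(1) map_map comp_def
        by (intro arg_cong[of _ _ sum_list] map_cong refl g_Inr[OF u(2) _ Inr(1)])
      then show ?thesis
        using row_sum_matching_entry[OF u(2), of x] hm
        by (simp add: sum_list_addf sum_list_triv length_matching_enum of_nat_diff algebra_simps)
    qed
  qed
  have det_V0: "det (list_mat (map Inl [0..<h - 1]) g) * x = x ^ (h - 1) * (x + of_nat (h - 1))"
    unfolding list_mat_map g_Inl
    using det_list_mat_add_const[of "[0..<h - 1]" "\<lambda>a b. if a = b then x else 0" x 1] row_Inl
    by (simp add: det_list_mat_diagonal)
  have det_V: "det (list_mat (map Inr (matching_enum m i)) g) * (x - 1) =
      (x\<^sup>2 - 1) ^ m * (x + of_nat (h - 1))" if "i \<in> {1..r}" for i
  proof -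
    have "list_mat (map Inr (matching_enum m i)) g =
        list_mat (matching_enum m i) (\<lambda>v w. matching_entry x v w + 1)"
      unfolding list_mat_map using that by (intro list_mat_cong g_Inr)
    moreover have "x - 1 + of_nat (2 * m) = x + of_nat (h - 1)"
      using hm by (simp add: of_nat_diff)
    ultimately show ?thesis
      using det_list_mat_add_const[of "matching_enum m i" "matching_entry x" "x - 1" 1]
      by (simp add: row_sum_matching_entry det_matching_entry length_matching_enum)
  qed
  have "(\<Prod>i\<leftarrow>[1..<Suc r]. det (list_mat (map Inr (matching_enum m i)) g)) * (x - 1) ^ r =
      (\<Prod>i\<in>{1..r}. det (list_mat (map Inr (matching_enum m i)) g) * (x - 1))"
    by (simp add: prod.distrib prod.distinct_set_conv_list[symmetric] atLeastLessThanSuc_atLeastAtMost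
        del: upt_Suc)
  also have "\<dots> = ((x\<^sup>2 - 1) ^ m * (x + of_nat (h - 1))) ^ r"
    using det_V by simp
  finally have det_Vs: "(\<Prod>i\<leftarrow>[1..<Suc r]. det (list_mat (map Inr (matching_enum m i)) g)) * (x - 1) ^ r =
      ((x\<^sup>2 - 1) ^ m * (x + of_nat (h - 1))) ^ r" .
  have "det (list_mat (X_enum h r) g) = det (list_mat (map Inl [0..<h - 1]) g) *
      (\<Prod>i\<leftarrow>[1..<Suc r]. det (list_mat (map Inr (matching_enum m i)) g))"
    unfolding X_enum det_list_mat_concat[OF blocks'] by (simp add: V_def comp_def del: upt_Suc)
  \<comment> \<open>Multiplying by the row sums of the blocks without \<open>J\<close>, namely
    \<open>x\<close> once and \<open>x - 1\<close> for each of the \<open>r\<close> matchings, makes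
    \<open>det_V0\<close> and \<open>det_Vs\<close> applicable.\<close>
  then have "det (list_mat (X_enum h r) g) * (x * (x - 1) ^ r) =
      (det (list_mat (map Inl [0..<h - 1]) g) * x) *
      ((\<Prod>i\<leftarrow>[1..<Suc r]. det (list_mat (map Inr (matching_enum m i)) g)) * (x - 1) ^ r)"
    by (simp only: ac_simps)
  then have det_g: "det (list_mat (X_enum h r) g) * (x * (x - 1) ^ r) =
      x ^ (h - 1) * (x + of_nat (h - 1)) * ((x\<^sup>2 - 1) ^ m * (x + of_nat (h - 1))) ^ r"
    by (simp only: det_V0 det_Vs)
  \<comment> \<open>Taking \<open>t = - 1\<close> removes \<open>J\<close>. With
    \<open>h - 1 + r * h\<close> vertices, the new row sum is \<open>x - of_nat (r * h)\<close>,
    where \<open>r * h\<close> is the degree of the graph.\<close>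
  have "det (list_mat (X_enum h r) (\<lambda>u v. g u v + (- 1))) * (x + of_nat (h - 1)) =
      det (list_mat (X_enum h r) g) *
      (x + of_nat (h - 1) + of_nat (length (X_enum h r)) * (- 1))"
    by (rule det_list_mat_add_const)
      (use sum_list_concat_blocks[OF blocks row] in \<open>auto simp: X_enum\<close>)
  moreover have "x + of_nat (h - 1) + of_nat (length (X_enum h r)) * (- 1) = x - of_nat (r * h)"
    using hm by (simp add: length_X_enum of_nat_diff)
  moreover have "(\<lambda>u v. g u v + (- 1)) = f"
    by (simp add: g_def fun_eq_iff)
  ultimately have "det (list_mat (X_enum h r) f) * (x + of_nat (h - 1)) =
      det (list_mat (X_enum h r) g) * (x - of_nat (r * h))"
    by simp
  then have "det (list_mat (X_enum h r) f) * (x * (x - 1) ^ r * (x + of_nat (h - 1))) =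
      det (list_mat (X_enum h r) g) * (x * (x - 1) ^ r) * (x - of_nat (r * h))"
    by (simp add: ac_simps)
  also have "\<dots> = x ^ (h - 1) * (x + of_nat (h - 1)) *
      ((x\<^sup>2 - 1) ^ m * (x + of_nat (h - 1))) ^ r * (x - of_nat (r * h))"
    by (simp only: det_g)
  also have "\<dots> = (x - of_nat (r * h)) * (x + of_nat (h - 1)) ^ r * (x - 1) ^ (r * (m - 1)) *
      x ^ (h - 2) * (x + 1) ^ (r * m) * (x * (x - 1) ^ r * (x + of_nat (h - 1)))"
  proof -
    \<comment> \<open>Split off one factor \<open>x\<close> and, below, \<open>r\<close> factors
      \<open>x - 1\<close>: exactly those to be cancelled. This lowers the exponents to
      \<open>h - 2\<close> and \<open>r * (m - 1)\<close>.\<close>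
    have "x ^ (h - 1) = x ^ (h - 2) * x"
      using hm by (cases m) auto
    moreover have "((x\<^sup>2 - 1) ^ m) ^ r = (x - 1) ^ (r * (m - 1)) * (x - 1) ^ r * (x + 1) ^ (r * m)"
    proof -
      have "x\<^sup>2 - 1 = (x - 1) * (x + 1)"
        by (simp add: power2_eq_square algebra_simps)
      then have "((x\<^sup>2 - 1) ^ m) ^ r = (x - 1) ^ (r * m) * (x + 1) ^ (r * m)"
        by (simp only: power_mult_distrib power_mult[symmetric] mult.commute)
      moreover have "r * m = r * (m - 1) + r"
        using hm(2) by (cases m) auto
      then have "(x - 1) ^ (r * m) = (x - 1) ^ (r * (m - 1)) * (x - 1) ^ r"
        by (simp only: power_add)
      ultimately show ?thesis
        by simp
    qed
    ultimately show ?thesis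
      by (simp add: power_mult_distrib ac_simps)
  qed
  finally have "det (list_mat (X_enum h r) f) =
      (x - of_nat (r * h)) * (x + of_nat (h - 1)) ^ r * (x - 1) ^ (r * (m - 1)) *
      x ^ (h - 2) * (x + 1) ^ (r * m)"
  \<comment> \<open>Since \<open>x\<close> is the polynomial variable, the factors to be cancelled
    are nonzero elements of an integral domain.\<close>
  proof (rule mult_right_cancel[THEN iffD1, rotated])
    have "x + of_nat (h - 1) \<noteq> 0" "x \<noteq> 0" "x - 1 \<noteq> 0"
      by (auto simp: x_def of_nat_poly one_pCons)
    then show "x * (x - 1) ^ r * (x + of_nat (h - 1)) \<noteq> 0"
      by simp
  qed
  moreover have "x - of_nat (r * h) = [:- of_nat (r * h), 1:]" "x - 1 = [:- 1, 1:]"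
    "x + of_nat (h - 1) = [:of_nat h - 1, 1:]" "x + 1 = [:1, 1:]"
    using h by (auto simp: x_def of_nat_poly one_pCons of_nat_diff simp del: of_nat_mult)
  moreover have "char_poly (adjacency_matrix (X_enum h r) (X_graph h r)) = det (list_mat (X_enum h r) f)"
    unfolding f_def x_def by (rule char_poly_adjacency_matrix[OF distinct_X_enum])
  moreover have "r * h div 2 = r * m"
    using hm by simp
  ultimately show ?thesis
    by (simp add: x_def m_def)
qed

section \<open>Integrality and the spectrum\<close>

theorem theorem4p1:
  fixes h r :: nat
  assumes "even h" and "h \<ge> 2" and "r \<ge> 1"
  shows "integral_graph (X_graph h r) \<and>
    adjacency_spectrum (X_graph h r) =
      replicate_mset 1 (of_nat (r * h)) +
      replicate_mset r (1 - of_nat h) +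
      replicate_mset (r * (h div 2 - 1)) 1 +
      replicate_mset (h - 2) 0 +
      replicate_mset (r * h div 2) (-1)"
proof
  let ?A = "adjacency_matrix (X_enum h r) (X_graph h r)"
  note fin = pair_graphD(1)[OF pair_graph_X_graph[of h r]]
  note char_poly = char_poly_X_graph[OF assms(1,2), of r]
  \<comment> \<open>Eigenvalues are roots of the characteristic polynomial, and each of its linear
    factors has an integer root.\<close>
  show "integral_graph (X_graph h r)"
    unfolding integral_graph_iff[OF fin is_vertex_enum_X_enum]
      eigenvalue_root_char_poly[OF adjacency_matrix_carrier] char_poly
    by (auto simp: add_eq_0_iff)
  show "adjacency_spectrum (X_graph h r) =
      replicate_mset 1 (of_nat (r * h)) +
      replicate_mset r (1 - of_nat h) +
      replicate_mset (r * (h div 2 - 1)) 1 +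
      replicate_mset (h - 2) 0 +
      replicate_mset (r * h div 2) (-1)"
    \<comment> \<open>Roots of a product add as multisets, which also covers coinciding eigenvalues.
      The deleted rules would multiply out the factored form.\<close>
    unfolding adjacency_spectrum_eq[OF fin is_vertex_enum_X_enum] char_poly
    by (simp add: proots_mult proots_power del: mult_pCons_left mult_pCons_right of_nat_mult)
qed

end
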